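(* Let $r\ge 1$, let $w_0\in\mathbb{C}^r$ and let $\mathcal{C}$ be a configuration (of the index set $\{1,\dots,r\}$). The collection $\mathcal{B}_{\mathcal{C}}(w_0)$ is a basis for $V_{w_0}$ if and only if $w_0$ is subordinated to $\mathcal{C}$. In this case, $\mathcal{B}_{\mathcal{C}}(w)$ is a continuous family of bases for $V_w$, for $w$ in a sufficiently small neighborhood of $w_0$ in $\mathbb{C}^r$.
   Context: **The space $V_w$.** For $w=(x_1,\dots,x_r)\in\mathbb{C}^r$ let $\tau_1,\dots,\tau_s$ be the distinct values among the coordinates, and $d_j$ the number of times $\tau_j$ appears. $V_w$ is the $r$-dimensional complex vector space of linear combinations of $\delta^{(\ell)}(x-\tau_j)$, $1\le j\le s$, $0\le\ell\le d_j-1$, viewed as linear functionals on functions $f$ holomorphic near the nodes; $\delta^{(\ell)}(x-\tau)$ acts, up to the sign $(-1)^\ell$ (irrelevant here), as $f\mapsto f^{(\ell)}(\tau)$. **Divided differences.** For points $y_1,\dots,y_n$ (repetitions allowed), the divided difference $\Delta^{n-1}(y_1,\dots,y_n)$ is the functional assigning to $f$ the coefficient of $x^{n-1}$ in the Hermite interpolation polynomial $P$ of degree $\le n-1$ satisfying $P^{(\ell)}(y_j)=f^{(\ell)}(y_j)$ for all $j$ and all $0\le\ell<\#\{i: y_i=y_j\}$. For $w=(x_1,\dots,x_r)$ and nonempty $X=\{n_1<\dots<n_\alpha\}\subseteq\{1,\dots,r\}$ put $\Delta_X(w)=\Delta^{\alpha-1}(x_{n_1},\dots,x_{n_\alpha})$.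 **Configurations.** A configuration $\mathcal{C}$ is a partition $\{1,\dots,r\}=X_1\sqcup\dots\sqcup X_s$ into nonempty subsets, $|X_j|=d_j$, $s=s(\mathcal{C})$ (these $s,d_j$ belong to $\mathcal{C}$, not to $w$). Write $X_j=\{n_1^j<\dots<n_{d_j}^j\}$ and $X_{j,m}=\{n_1^j,\dots,n_m^j\}$ for $1\le m\le d_j$. Set $$\mathcal{B}_{\mathcal{C}}(w)=\{\Delta_{X_{j,m}}(w)\}_{1\le j\le s(\mathcal{C}),\,1\le m\le d_j}\subset V_w,$$ an indexed family of $r$ elements. A point $w=(x_1,\dots,x_r)$ is *subordinated* to $\mathcal{C}$ if whenever $x_k=x_\ell$ with $k\ne\ell$, the indices $k,\ell$ lie in the same $X_j$. **Continuity.** A family of functionals depending on $w$ is continuous if its value on each test function (e.g. each entire function) is continuous in $w$. *)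

theory Defs
  imports "HOL-Complex_Analysis.Complex_Analysis" "HOL-Library.Function_Algebras"
    "HOL-Library.Disjoint_Sets"
begin

text \<open>Points of \<open>\<complex>\<^sup>r\<close> are vectors indexed by a finite, linearly ordered type, which plays the role of
  \<open>{1,\<dots>,r}\<close>; the order is used to list the elements of an index set increasingly.\<close>

definition nodes :: "complex ^ 'n \<Rightarrow> complex set" where
  "nodes w = range (\<lambda>i. w $ i)"

definition node_mult :: "complex ^ 'n \<Rightarrow> complex \<Rightarrow> nat" where
  "node_mult w \<tau> = card {i. w $ i = \<tau>}"

type_synonym functional = "(complex \<Rightarrow> complex) \<Rightarrow> complex"

interpretation functional: vector_space "\<lambda>(c::complex) (\<phi>::functional) f. c * \<phi> f"
  by unfold_locales (auto simp: fun_eq_iff algebra_simps)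

text \<open>A functional on the space of functions holomorphic near the nodes of \<open>w\<close> is represented by
  its extension by \<open>0\<close> to all functions, so that equality and linear relations in the type
  \<open>functional\<close> only concern functions holomorphic near the nodes.\<close>

definition near_nodes :: "complex ^ 'n \<Rightarrow> functional \<Rightarrow> functional" where
  "near_nodes w \<phi> = (\<lambda>f. if f analytic_on nodes w then \<phi> f else 0)"

text \<open>The sign \<open>(-1)\<^sup>l\<close> in the action of the \<open>l\<close>-th derivative of the Dirac delta is dropped.\<close>

definition delta :: "complex ^ 'n \<Rightarrow> nat \<Rightarrow> complex \<Rightarrow> functional" where
  "delta w l \<tau> = near_nodes w (\<lambda>f. (deriv ^^ l) f \<tau>)"

definition V_space :: "complex ^ 'n \<Rightarrow> functional set" where
  "V_space w = functional.span {delta w l \<tau> | l \<tau>. \<tau> \<in> nodes w \<and> l < node_mult w \<tau>}"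

definition hermite_poly :: "complex list \<Rightarrow> (complex \<Rightarrow> complex) \<Rightarrow> complex poly" where
  "hermite_poly ys f = (THE P. degree P \<le> length ys - 1 \<and>
     (\<forall>y\<in>set ys. \<forall>l<count_list ys y. (deriv ^^ l) (poly P) y = (deriv ^^ l) f y))"

definition divided_difference :: "complex list \<Rightarrow> functional" where
  "divided_difference ys f = coeff (hermite_poly ys f) (length ys - 1)"

definition Delta :: "'n::{finite,linorder} set \<Rightarrow> complex ^ 'n::{finite,linorder} \<Rightarrow> functional" where
  "Delta X w = near_nodes w (divided_difference (map (\<lambda>i. w $ i) (sorted_list_of_set X)))"

definition configuration :: "'n set set \<Rightarrow> bool" where
  "configuration C \<longleftrightarrow> partition_on UNIV C"

definition initial_part :: "'n::{finite,linorder} set \<Rightarrow> nat \<Rightarrow> 'n set" where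
  "initial_part X m = set (take m (sorted_list_of_set X))"

text \<open>The index \<open>(X\<^sub>j, m)\<close> stands for the pair \<open>(j, m)\<close>, so the blocks need no numbering.\<close>

definition family_index :: "'n set set \<Rightarrow> ('n set \<times> nat) set" where
  "family_index C = (SIGMA X:C. {1..card X})"

definition B_family ::
    "complex ^ 'n::{finite,linorder} \<Rightarrow> 'n set \<times> nat \<Rightarrow> functional" where
  "B_family w = (\<lambda>(X, m). Delta (initial_part X m) w)"

definition subordinated :: "complex ^ 'n \<Rightarrow> 'n set set \<Rightarrow> bool" where
  "subordinated w C \<longleftrightarrow> (\<forall>k l. k \<noteq> l \<and> w $ k = w $ l \<longrightarrow> (\<exists>X\<in>C. k \<in> X \<and> l \<in> X))"

definition is_basis_family :: "'i set \<Rightarrow> ('i \<Rightarrow> functional) \<Rightarrow> functional set \<Rightarrow> bool" where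
  "is_basis_family I b W \<longleftrightarrow>
     inj_on b I \<and> functional.independent (b ` I) \<and> functional.span (b ` I) = W"

text \<open>A test function \<open>f\<close> is only required to be in the domain of the functionals at the points \<open>w\<close>
  where continuity is tested; for entire \<open>f\<close> this is all of \<open>U\<close>.\<close>

definition continuous_functionals_on ::
    "(complex ^ 'n) set \<Rightarrow> (complex ^ 'n \<Rightarrow> functional) \<Rightarrow> bool" where
  "continuous_functionals_on U \<Phi> \<longleftrightarrow>
     (\<forall>f. continuous_on {w \<in> U. f analytic_on nodes w} (\<lambda>w. \<Phi> w f))"

end

theory Submission
  imports Defs
begin

text \<open>Every functional in question depends on \<open>f\<close> only through its jets at the nodes, and jets at
  distinct points can be prescribed independently: a function that is one polynomial near some
  nodes and \<open>0\<close> near the others is analytic near all of them. The algebraic half of the theorem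
  is therefore a matter of choosing such test functions.

  Suppose \<open>w\<close> is subordinated to \<open>C\<close>. Then different blocks have different node values. For an
  index \<open>(X, m)\<close> take the function that is the product of \<open>z - w\<^sub>i\<close> over the first \<open>m - 1\<close>
  indices of \<open>X\<close> near the nodes of \<open>X\<close>, and \<open>0\<close> near all other nodes. A divided difference over a shorter
  initial part of \<open>X\<close> kills it because it vanishes there; over a longer one because its
  degree is too small; over exactly \<open>m\<close> points it gives the leading coefficient \<open>1\<close>; and another
  block sees only zeros. These functions are thus dual to the family
  (\<open>B_family_dual_function\<close>), which is independent as a consequence. It lies in the space
  \<open>V_space w\<close> (\<open>Delta_in_V_space\<close>), it has as many members as there are indices, and the space is
  spanned by at most that many functionals, so it is a basis.

  Conversely, if some value \<open>\<tau>\<close> of multiplicity \<open>\<mu>\<close> is shared by two blocks, no block contains all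
  the indices with that value, so no member of the family involves a derivative of order
  \<open>\<mu> - 1\<close> at \<open>\<tau>\<close>. The space contains that derivative, hence the family does not span it.

  Being subordinated is a finite set of conditions \<open>w\<^sub>k \<noteq> w\<^sub>l\<close>, so it persists in a
  neighbourhood. For the continuity, Newton's form of the interpolation polynomial expresses a
  divided difference by iterating
  \<open>f \<mapsto> (f z - f y) / (z - y)\<close> (\<open>divided_difference_eq_iterated_quotient\<close>). This quotient depends
  continuously on all its data, also across \<open>z = y\<close>, because Cauchy's formula writes it as an
  integral over a circle that stays away from both points
  (\<open>continuous_on_difference_quotient\<close>).\<close>

section \<open>Newton's form of the Hermite interpolation polynomial\<close>

text \<open>The Hermite interpolation conditions, as a relation between two arbitrary functions so that it
  also applies to functions that are not polynomials.\<close>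

definition jets_agree :: "complex list \<Rightarrow> (complex \<Rightarrow> complex) \<Rightarrow> (complex \<Rightarrow> complex) \<Rightarrow> bool" where
  "jets_agree ys f g \<longleftrightarrow> (\<forall>y\<in>set ys. \<forall>l<count_list ys y. (deriv ^^ l) f y = (deriv ^^ l) g y)"

text \<open>The value at \<open>y\<close> fills the removable singularity, which keeps the quotient holomorphic
  on every open set around \<open>y\<close> on which \<open>f\<close> is.\<close>

definition difference_quotient :: "complex \<Rightarrow> (complex \<Rightarrow> complex) \<Rightarrow> complex \<Rightarrow> complex" where
  "difference_quotient y f = (\<lambda>z. if z = y then deriv f y else (f z - f y) / (z - y))"

text \<open>The recursion rests on \<open>f z = f y + (z - y) * g z\<close> with \<open>g\<close> the difference quotient of \<open>f\<close> at \<open>y\<close>: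
  interpolating \<open>g\<close> at the remaining nodes interpolates \<open>f\<close> at all of them, multiplicities
  included.\<close>

fun newton_poly :: "complex list \<Rightarrow> (complex \<Rightarrow> complex) \<Rightarrow> complex poly" where
  "newton_poly [] f = 0"
| "newton_poly (y # ys) f = [:f y:] + [:- y, 1:] * newton_poly ys (difference_quotient y f)"

text \<open>The top coefficient of Newton's polynomial. Unlike the polynomial, it keeps the recursion in a
  form to which continuity in the nodes can be passed along.\<close>

fun iterated_quotient :: "complex list \<Rightarrow> (complex \<Rightarrow> complex) \<Rightarrow> complex" where
  "iterated_quotient [] f = 0"
| "iterated_quotient [y] f = f y"
| "iterated_quotient (y # ys) f = iterated_quotient ys (difference_quotient y f)"

lemma holomorphic_difference_quotient:
  assumes "f holomorphic_on S" "open S" "y \<in> S"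
  shows "difference_quotient y f holomorphic_on S"
  unfolding difference_quotient_def using assms by (intro pole_lemma) (auto simp: interior_open)

lemma degree_newton_poly: "degree (newton_poly ys f) \<le> length ys - 1"
proof (induction ys arbitrary: f)
  case (Cons y ys)
  let ?N = "newton_poly ys (difference_quotient y f)"
  show ?case
  proof (cases "ys = []")
    case False
    have "degree ([:- y, 1:] * ?N) \<le> 1 + degree ?N"
      using degree_mult_le[of "[:- y, 1:]" ?N] by simp
    also have "\<dots> \<le> length ys"
      using Cons.IH[of "difference_quotient y f"] False by (cases ys) auto
    finally show ?thesis by (auto intro!: degree_add_le)
  qed auto
qed auto

lemma coeff_newton_poly: "coeff (newton_poly ys f) (length ys - 1) = iterated_quotient ys f"
proof (induction ys f rule: iterated_quotient.induct)
  case (3 y y' ys f)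
  let ?N = "newton_poly (y' # ys) (difference_quotient y f)"
  have "coeff ?N (Suc (length ys)) = 0"
    using degree_newton_poly[of "y' # ys" "difference_quotient y f"] by (intro coeff_eq_0) auto
  hence "coeff (newton_poly (y # y' # ys) f) (Suc (length ys)) = coeff ?N (length ys)"
    by (simp add: newton_poly.simps(2)[of y "y' # ys"] del: newton_poly.simps)
  thus ?case using 3 by simp
qed auto

text \<open>The error of Newton's polynomial is divisible by the nodal polynomial with a holomorphic
  quotient: each difference quotient splits off one more factor \<open>z - y\<close>. Divisibility encodes all
  interpolation conditions at once, without distinguishing repeated from distinct nodes.\<close>

lemma newton_poly_remainder:
  assumes "open S" "f holomorphic_on S" "set ys \<subseteq> S"
  obtains h where "h holomorphic_on S"
    "\<And>z. z \<in> S \<Longrightarrow> f z = poly (newton_poly ys f) z + (\<Prod>y\<leftarrow>ys. z - y) * h z"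
  using assms(2,3)
proof (induction ys arbitrary: f thesis)
  case Nil
  thus ?case by (metis (no_types, lifting) add_0 list.map(1) mult_1 newton_poly.simps(1) poly_0 prod_list.Nil)
next
  case (Cons y ys)
  obtain h where h: "h holomorphic_on S" "\<And>z. z \<in> S \<Longrightarrow> difference_quotient y f z =
      poly (newton_poly ys (difference_quotient y f)) z + (\<Prod>y\<leftarrow>ys. z - y) * h z"
    using Cons.IH[of "difference_quotient y f"] holomorphic_difference_quotient[of f S y] assms(1) Cons.prems
    by auto
  have "f z = poly (newton_poly (y # ys) f) z + (\<Prod>y\<leftarrow>y # ys. z - y) * h z" if "z \<in> S" for z
  proof -
    have "f z = f y + (z - y) * difference_quotient y f z"
      by (simp add: difference_quotient_def)
    thus ?thesis by (simp add: h(2)[OF that] algebra_simps)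
  qed
  thus ?case using Cons.prems(1) h(1) by blast
qed

text \<open>In Leibniz' formula the \<open>l\<close>-th derivative at \<open>y\<close> retains only the terms in which the power is
  differentiated \<open>k\<close> times. The case \<open>l < k\<close> gives the vanishing of jets; the case \<open>l = k\<close>
  detects the exact order of a zero.\<close>

lemma higher_deriv_power_times:
  assumes "h holomorphic_on S" "open S" "y \<in> S" "l \<le> k"
  shows "(deriv ^^ l) (\<lambda>z. (z - y) ^ k * h z) y = (if l = k then fact k * h y else 0)"
proof -
  have p: "(deriv ^^ i) (\<lambda>z. (z - y) ^ k) y = (if i = k then fact k else 0)" if "i \<le> k" for i
    using that by (auto simp: higher_deriv_power pochhammer_fact)
  have "(deriv ^^ l) (\<lambda>z. (z - y) ^ k * h z) y =
      (\<Sum>i = 0..l. of_nat (l choose i) * (deriv ^^ i) (\<lambda>z. (z - y) ^ k) y * (deriv ^^ (l - i)) h y)"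
    using assms by (intro higher_deriv_mult[of _ S]) (auto intro!: holomorphic_intros)
  also have "\<dots> = (\<Sum>i = 0..l. if i = k then fact k * h y else 0)"
    using assms(4) by (intro sum.cong refl) (auto simp: p)
  also have "\<dots> = (if l = k then fact k * h y else 0)"
    using assms(4) by auto
  finally show ?thesis .
qed

lemma prod_list_linear_split:
  "(\<Prod>y'\<leftarrow>ys. z - y') = (z - y) ^ count_list ys y * (\<Prod>y'\<leftarrow>filter (\<lambda>y'. y' \<noteq> y) ys. (z - y' :: complex))"
  by (induction ys) auto

lemma holomorphic_prod_list_linear:
  "(\<lambda>z. \<Prod>y\<leftarrow>ys. z - y) holomorphic_on S" for ys :: "complex list"
  by (induction ys) (auto intro!: holomorphic_intros)

lemma jets_agree_nodal_multiple:
  assumes "open S" "h holomorphic_on S" "set ys \<subseteq> S"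
  shows "jets_agree ys (\<lambda>z. (\<Prod>y\<leftarrow>ys. z - y) * h z) (\<lambda>_. 0)"
  unfolding jets_agree_def
proof safe
  fix y l assume y: "y \<in> set ys" "l < count_list ys y"
  let ?h = "\<lambda>z. (\<Prod>y'\<leftarrow>filter (\<lambda>y'. y' \<noteq> y) ys. z - y') * h z"
  have "(\<lambda>z. (\<Prod>y\<leftarrow>ys. z - y) * h z) = (\<lambda>z. (z - y) ^ count_list ys y * ?h z)"
    by (subst prod_list_linear_split[of _ ys y]) (simp add: mult.assoc)
  moreover have "(deriv ^^ l) (\<lambda>z. (z - y) ^ count_list ys y * ?h z) y = 0"
    using y assms by (subst higher_deriv_power_times[of _ S])
      (auto intro!: holomorphic_intros holomorphic_prod_list_linear)
  ultimately show "(deriv ^^ l) (\<lambda>z. (\<Prod>y\<leftarrow>ys. z - y) * h z) y = (deriv ^^ l) (\<lambda>_. 0) y"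
    by simp
qed

lemma jets_agree_newton_poly:
  assumes "f analytic_on set ys"
  shows "jets_agree ys (poly (newton_poly ys f)) f"
proof -
  obtain S where S: "open S" "set ys \<subseteq> S" "f holomorphic_on S"
    using assms by (auto simp: analytic_on_holomorphic)
  obtain h where h: "h holomorphic_on S"
    "\<And>z. z \<in> S \<Longrightarrow> f z = poly (newton_poly ys f) z + (\<Prod>y\<leftarrow>ys. z - y) * h z"
    using newton_poly_remainder S by metis
  let ?r = "\<lambda>z. (\<Prod>y\<leftarrow>ys. z - y) * h z"
  have hol: "?r holomorphic_on S" "poly (newton_poly ys f) holomorphic_on S"
    using h by (auto intro!: holomorphic_intros holomorphic_prod_list_linear)
  show ?thesis unfolding jets_agree_def
  proof safe
    fix y l assume y: "y \<in> set ys" "l < count_list ys y"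
    have "(deriv ^^ l) f y = (deriv ^^ l) (\<lambda>z. poly (newton_poly ys f) z + ?r z) y"
      using y S h hol by (intro higher_deriv_transform_within_open[of _ S]) (auto intro!: holomorphic_intros)
    also have "\<dots> = (deriv ^^ l) (poly (newton_poly ys f)) y + (deriv ^^ l) ?r y"
      using y S hol by (intro higher_deriv_add[of _ S]) auto
    also have "(deriv ^^ l) ?r y = 0"
      using jets_agree_nodal_multiple[OF S(1) h(1) S(2)] y by (simp add: jets_agree_def)
    finally show "(deriv ^^ l) (poly (newton_poly ys f)) y = (deriv ^^ l) f y" by simp
  qed
qed

text \<open>This is the uniqueness of Hermite interpolation. By the exact order of vanishing, each node is a
  root of multiplicity at least its number of occurrences, so \<open>ys\<close> is contained in the multiset of
  roots, which is too small for that unless \<open>P = 0\<close>.\<close>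

lemma jets_agree_poly_zero:
  assumes "jets_agree ys (poly P) (\<lambda>_. 0)" "degree P < length ys"
  shows "P = 0"
proof (rule ccontr)
  assume nz: "P \<noteq> 0"
  have "count_list ys y \<le> order y P" if "y \<in> set ys" for y
  proof (rule ccontr)
    assume *: "\<not> count_list ys y \<le> order y P"
    obtain q where q: "P = [:- y, 1:] ^ order y P * q" "\<not> [:- y, 1:] dvd q"
      using order_decomp nz by blast
    have "poly P = (\<lambda>z. (z - y) ^ order y P * poly q z)"
      by (subst q) (auto simp: fun_eq_iff)
    hence "(deriv ^^ order y P) (poly P) y = fact (order y P) * poly q y"
      using higher_deriv_power_times[of "poly q" UNIV y "order y P" "order y P"] by (simp add: holomorphic_intros)
    moreover have "(deriv ^^ order y P) (poly P) y = 0"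
      using assms(1) that * by (simp add: jets_agree_def)
    ultimately show False using q(2) by (simp add: poly_eq_0_iff_dvd)
  qed
  hence "mset ys \<subseteq># proots P"
    using nz by (intro mset_subset_eqI) (metis count_list_0_iff count_mset count_proots le0)
  hence "length ys \<le> size (proots P)" by (metis size_mset size_mset_mono)
  also have "\<dots> \<le> degree P" by (rule size_proots_le)
  finally show False using assms(2) by simp
qed

lemma hermite_poly_eqI:
  assumes "ys \<noteq> []" "degree P \<le> length ys - 1" "jets_agree ys (poly P) f"
  shows "hermite_poly ys f = P"
  unfolding hermite_poly_def
proof (rule the_equality)
  show "degree P \<le> length ys - 1 \<and>
      (\<forall>y\<in>set ys. \<forall>l<count_list ys y. (deriv ^^ l) (poly P) y = (deriv ^^ l) f y)"
    using assms by (auto simp: jets_agree_def)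
next
  fix Q assume Q: "degree Q \<le> length ys - 1 \<and>
      (\<forall>y\<in>set ys. \<forall>l<count_list ys y. (deriv ^^ l) (poly Q) y = (deriv ^^ l) f y)"
  have "(deriv ^^ l) (poly (Q - P)) y = (deriv ^^ l) (poly Q) y - (deriv ^^ l) (poly P) y" for l y
  proof -
    have "poly (Q - P) = (\<lambda>z. poly Q z - poly P z)" by (simp add: fun_eq_iff)
    thus ?thesis
      using higher_deriv_diff[of "poly Q" UNIV "poly P" y l] by (simp add: holomorphic_intros)
  qed
  hence "jets_agree ys (poly (Q - P)) (\<lambda>_. 0)"
    using Q assms(3) by (simp add: jets_agree_def)
  moreover have "degree (Q - P) < length ys"
    using Q assms(1,2) degree_diff_le[of Q "length ys - 1" P] by (cases ys) auto
  ultimately show "Q = P" using jets_agree_poly_zero by fastforce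
qed

lemma divided_difference_eq_iterated_quotient:
  assumes "ys \<noteq> []" "f analytic_on set ys"
  shows "divided_difference ys f = iterated_quotient ys f"
  using hermite_poly_eqI[OF assms(1) degree_newton_poly jets_agree_newton_poly[OF assms(2)]]
  by (simp only: divided_difference_def coeff_newton_poly)

text \<open>Evaluating a divided difference amounts to guessing the interpolation polynomial. Only the
  jets of \<open>f\<close> enter; \<open>f\<close> need not be given by a formula.\<close>

lemma divided_difference_poly:
  assumes "ys \<noteq> []" "degree P \<le> length ys - 1" "jets_agree ys f (poly P)"
  shows "divided_difference ys f = coeff P (length ys - 1)"
  using hermite_poly_eqI[OF assms(1,2)] assms(3) by (simp add: divided_difference_def jets_agree_def)

lemma divided_difference_eq_0:
  assumes "ys \<noteq> []" "jets_agree ys f (\<lambda>_. 0)"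
  shows "divided_difference ys f = 0"
proof -
  have "poly 0 = (\<lambda>_. 0 :: complex)" by (simp add: fun_eq_iff)
  thus ?thesis using divided_difference_poly[of ys 0 f] assms by simp
qed

section \<open>Continuity of divided differences\<close>

text \<open>On the circle the difference quotient is an honest quotient, since \<open>y\<close> lies inside; so
  Cauchy's formula for it removes the case distinction at \<open>z = y\<close>.\<close>

lemma difference_quotient_Cauchy:
  assumes "f holomorphic_on S" "open S" "cball a \<rho> \<subseteq> S" "y \<in> ball a \<rho>" "z \<in> ball a \<rho>"
  shows "difference_quotient y f z =
    contour_integral (circlepath a \<rho>) (\<lambda>\<zeta>. (f \<zeta> - f y) / (\<zeta> - y) / (\<zeta> - z)) / (2 * of_real pi * \<i>)"
proof -
  have \<rho>: "\<rho> > 0" using assms(4) by (metis mem_ball zero_le_dist order_le_less_trans)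
  have y: "y \<in> S" using assms by auto
  have "((\<lambda>\<zeta>. difference_quotient y f \<zeta> / (\<zeta> - z)) has_contour_integral
      (2 * of_real pi * \<i> * difference_quotient y f z)) (circlepath a \<rho>)"
    using holomorphic_difference_quotient[OF assms(1,2) y] assms(3,5)
    by (intro Cauchy_integral_circlepath_simple)
      (auto simp: dist_norm norm_minus_commute intro: holomorphic_on_subset)
  hence "contour_integral (circlepath a \<rho>) (\<lambda>\<zeta>. difference_quotient y f \<zeta> / (\<zeta> - z)) =
      2 * of_real pi * \<i> * difference_quotient y f z"
    by (rule contour_integral_unique)
  moreover have "contour_integral (circlepath a \<rho>) (\<lambda>\<zeta>. difference_quotient y f \<zeta> / (\<zeta> - z)) =
      contour_integral (circlepath a \<rho>) (\<lambda>\<zeta>. (f \<zeta> - f y) / (\<zeta> - y) / (\<zeta> - z))"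
    using assms(4) \<rho> by (intro contour_integral_cong) (auto simp: difference_quotient_def)
  ultimately show ?thesis by simp
qed

text \<open>The function is allowed to depend on the parameter because the recursion for the divided
  difference applies the next quotient to one that already depends on the nodes.\<close>

lemma continuous_on_difference_quotient:
  fixes F :: "'p::t2_space \<Rightarrow> complex \<Rightarrow> complex"
  assumes S: "open S" and hol: "\<And>p. p \<in> A \<Longrightarrow> F p holomorphic_on S"
    and F: "continuous_on (A \<times> S) (\<lambda>(p, z). F p z)"
    and y: "continuous_on A y" "\<And>p. p \<in> A \<Longrightarrow> y p \<in> S"
  shows "continuous_on (A \<times> S) (\<lambda>(p, z). difference_quotient (y p) (F p) z)"
proof -
  have Fy: "continuous_on A (\<lambda>p. F p (y p))"
    by (rule continuous_on_compose2[OF F, of _ "\<lambda>p. (p, y p)", simplified])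
      (auto intro!: continuous_intros y)
  let ?D = "\<lambda>x. difference_quotient (y (fst x)) (F (fst x)) (snd x)"
  \<comment> \<open>Away from the diagonal the defining fraction is continuous; near it, the integral is.\<close>
  have local: "\<exists>T. open T \<and> x \<in> T \<and> continuous_on (A \<times> S \<inter> T) ?D" if x: "x \<in> A \<times> S" for x
  proof (cases "snd x = y (fst x)")
    case False
    have yf: "continuous_on (A \<times> S) (\<lambda>x. y (fst x))"
      by (intro continuous_on_compose2[OF y(1)] continuous_intros) auto
    have "openin (top_of_set (A \<times> S)) (A \<times> S \<inter> (\<lambda>x. snd x - y (fst x)) -` (- {0}))"
      by (intro continuous_openin_preimage_gen continuous_intros yf)
    then obtain T where T: "open T" "A \<times> S \<inter> (\<lambda>x. snd x - y (fst x)) -` (- {0}) = A \<times> S \<inter> T"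
      by (auto simp: openin_open)
    have off: "snd x \<noteq> y (fst x)" if "x \<in> A \<times> S \<inter> T" for x
      using that unfolding T(2)[symmetric] by auto
    have "continuous_on (A \<times> S \<inter> T)
        (\<lambda>x. (F (fst x) (snd x) - F (fst x) (y (fst x))) / (snd x - y (fst x)))"
      by (intro continuous_intros continuous_on_subset[OF yf]
          continuous_on_subset[OF F[unfolded case_prod_unfold]] continuous_on_compose2[OF Fy]) (use off in auto)
    also have "?this \<longleftrightarrow> continuous_on (A \<times> S \<inter> T) ?D"
      using off by (intro continuous_on_cong) (auto simp: difference_quotient_def)
    finally have "continuous_on (A \<times> S \<inter> T) ?D" .
    moreover have "x \<in> A \<times> S \<inter> (\<lambda>x. snd x - y (fst x)) -` (- {0})"
      using x False by auto
    hence "x \<in> T" by (subst (asm) T(2)) (rule IntD2)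
    ultimately show ?thesis using T(1) by (intro exI[of _ T] conjI)
  next
    case True
    define a where "a = snd x"
    have "a \<in> S" using x by (auto simp: a_def)
    then obtain \<rho> where \<rho>: "\<rho> > 0" "cball a \<rho> \<subseteq> S" using S[unfolded open_contains_cball] by blast
    have "openin (top_of_set A) (A \<inter> y -` ball a \<rho>)"
      by (intro continuous_openin_preimage_gen y) auto
    then obtain T where T: "open T" "A \<inter> y -` ball a \<rho> = A \<inter> T"
      by (auto simp: openin_open)
    define c where "c = circlepath a \<rho>"
    have c: "c t \<in> S" "c t \<notin> ball a \<rho>" if "t \<in> {0..1}" for t
    proof -
      have "c t \<in> path_image c" using that by (auto simp: path_image_def)
      hence "c t \<in> sphere a \<rho>" using \<rho>(1) by (simp add: c_def)
      thus "c t \<in> S" "c t \<notin> ball a \<rho>" using \<rho>(2) by auto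
    qed
    have cc: "continuous_on UNIV c"
      unfolding c_def circlepath by (intro continuous_intros)
    define V where "V = (A \<inter> y -` ball a \<rho>) \<times> ball a \<rho>"
    define G where "G = (\<lambda>(x::'p \<times> complex) t. (F (fst x) (c t) - F (fst x) (y (fst x))) /
        (c t - y (fst x)) / (c t - snd x) * vector_derivative c (at t))"
    have inV: "fst x \<in> A" "y (fst x) \<in> ball a \<rho>" "snd x \<in> ball a \<rho>" if "x \<in> V" for x
      using that by (auto simp: V_def)
    have c_snd: "continuous_on (V \<times> {0..1}) (\<lambda>x. c (snd x))"
      by (rule continuous_on_compose2[OF cc]) (auto intro!: continuous_intros)
    have "continuous_on (V \<times> {0..1}) (\<lambda>(x, t). G x t)"
      unfolding G_def case_prod_unfold
    proof (intro continuous_on_mult continuous_on_divide continuous_on_diff)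
      show "continuous_on (V \<times> {0..1}) (\<lambda>x. F (fst (fst x)) (c (snd x)))"
        by (rule continuous_on_compose2[OF F, of _ "\<lambda>x. (fst (fst x), c (snd x))", simplified])
          (auto intro!: continuous_intros continuous_on_compose2[OF cc] c dest: inV)
      show "continuous_on (V \<times> {0..1}) (\<lambda>x. F (fst (fst x)) (y (fst (fst x))))"
        by (rule continuous_on_compose2[OF Fy]) (auto intro!: continuous_intros dest: inV)
      show "continuous_on (V \<times> {0..1}) (\<lambda>x. y (fst (fst x)))"
        by (rule continuous_on_compose2[OF y(1)]) (auto intro!: continuous_intros dest: inV)
      show "continuous_on (V \<times> {0..1}) (\<lambda>x. snd (fst x))"
        by (intro continuous_intros)
      show "continuous_on (V \<times> {0..1}) (\<lambda>x. vector_derivative c (at (snd x)))"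
        unfolding c_def vector_derivative_circlepath by (intro continuous_intros)
      show "\<forall>x\<in>V \<times> {0..1}. c (snd x) - y (fst (fst x)) \<noteq> 0"
        "\<forall>x\<in>V \<times> {0..1}. c (snd x) - snd (fst x) \<noteq> 0"
        using c(2) inV by (metis eq_iff_diff_eq_0 mem_Times_iff)+
    qed (rule c_snd)+
    hence "continuous_on V (\<lambda>x. integral {0..1} (G x))"
      by (rule integral_continuous_on_param[of V 0 1 G, unfolded cbox_interval])
    hence "continuous_on V (\<lambda>x. integral {0..1} (G x) / (2 * of_real pi * \<i>))"
      by (rule continuous_on_divide[OF _ continuous_on_const]) simp
    also have "?this \<longleftrightarrow> continuous_on V ?D"
    proof (intro continuous_on_cong refl)
      fix x assume "x \<in> V"
      from inV[OF this] show "integral {0..1} (G x) / (2 * of_real pi * \<i>) = ?D x"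
        using difference_quotient_Cauchy[OF hol S \<rho>(2), of "fst x" "y (fst x)" "snd x"]
        by (simp add: contour_integral_integral G_def c_def)
    qed
    also have "V = A \<times> S \<inter> T \<times> ball a \<rho>" 
      unfolding V_def T(2) using \<rho>(2) by auto
    finally have "continuous_on (A \<times> S \<inter> T \<times> ball a \<rho>) ?D" .
    moreover have "x \<in> T \<times> ball a \<rho>"
    proof -
      have "fst x \<in> A \<inter> y -` ball a \<rho>" using x True \<rho>(1) by (auto simp: a_def)
      hence "fst x \<in> T" unfolding T(2) by simp
      thus ?thesis using \<rho>(1) by (simp add: mem_Times_iff a_def)
    qed
    ultimately show ?thesis using T(1) by (intro exI[of _ "T \<times> ball a \<rho>"] conjI open_Times open_ball)
  qed
  have "continuous_on (A \<times> S) ?D"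
    unfolding continuous_on_eq_continuous_within
  proof
    fix x assume x: "x \<in> A \<times> S"
    obtain T where T: "open T" "x \<in> T" "continuous_on (A \<times> S \<inter> T) ?D"
      using local[OF x] by (elim exE conjE)
    have "continuous (at x within A \<times> S \<inter> T) ?D"
      using T(3) x T(2) unfolding continuous_on_eq_continuous_within by (elim bspec) (rule IntI)
    moreover have "at x within A \<times> S \<inter> T = at x within A \<times> S"
      by (rule at_within_nhd[OF T(2,1)]) blast
    ultimately show "continuous (at x within A \<times> S) ?D" by (simp only:)
  qed
  thus ?thesis by (simp add: case_prod_unfold)
qed

lemma continuous_on_iterated_quotient:
  fixes F :: "'p::t2_space \<Rightarrow> complex \<Rightarrow> complex"
  assumes "open S" "\<And>p. p \<in> A \<Longrightarrow> F p holomorphic_on S"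
    "continuous_on (A \<times> S) (\<lambda>(p, z). F p z)"
    "\<And>y. y \<in> set ys \<Longrightarrow> continuous_on A y" "\<And>y p. y \<in> set ys \<Longrightarrow> p \<in> A \<Longrightarrow> y p \<in> S"
  shows "continuous_on A (\<lambda>p. iterated_quotient (map (\<lambda>y. y p) ys) (F p))"
  using assms(2-)
proof (induction ys arbitrary: F rule: induct_list012)
  case (2 y)
  have "continuous_on A (\<lambda>p. F p (y p))"
    by (rule continuous_on_compose2[OF 2(2), of _ "\<lambda>p. (p, y p)", simplified])
      (use 2 in \<open>auto intro!: continuous_intros\<close>)
  thus ?case by simp
next
  case (3 y y' ys)
  have "continuous_on A (\<lambda>p. iterated_quotient (map (\<lambda>y. y p) (y' # ys)) (difference_quotient (y p) (F p)))"
    using 3(3-) by (intro 3(2) holomorphic_difference_quotient continuous_on_difference_quotient assms(1)) auto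
  thus ?case by simp
qed auto

section \<open>Functions with prescribed jets\<close>

text \<open>Analyticity on a finite set constrains a function only near its points, so the two pieces can
  be given on disjoint neighbourhoods of \<open>A\<close> and of its complement in \<open>S\<close>.\<close>

lemma exists_piecewise_analytic:
  assumes "finite S" "A \<subseteq> S" "g holomorphic_on UNIV"
  obtains f where "f analytic_on S" "\<And>y l. y \<in> A \<Longrightarrow> (deriv ^^ l) f y = (deriv ^^ l) g y"
    "\<And>y l. y \<in> S - A \<Longrightarrow> (deriv ^^ l) f y = 0"
proof -
  obtain U V where UV: "open U" "open V" "A \<subseteq> U" "S - A \<subseteq> V" "U \<inter> V = {}"
    using separation_normal[of A "S - A"] assms(1,2)
    by (metis Diff_disjoint finite_Diff finite_imp_closed rev_finite_subset)
  define f where "f = (\<lambda>z. if z \<in> U then g z else 0)"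
  have g: "g holomorphic_on U" using assms(3) holomorphic_on_subset by blast
  have "f holomorphic_on U \<union> V"
    unfolding f_def using g UV by (intro holomorphic_on_If_Un) auto
  moreover from this have f: "f holomorphic_on U" "f holomorphic_on V"
    by (auto intro: holomorphic_on_subset)
  have "S \<subseteq> U \<union> V" using UV by blast
  ultimately have "f analytic_on S"
    unfolding analytic_on_holomorphic using UV(1,2) by (intro exI[of _ "U \<union> V"] conjI open_Un)
  moreover have "(deriv ^^ l) f y = (deriv ^^ l) g y" if "y \<in> A" for y l
    using that UV g f by (intro higher_deriv_transform_within_open[of _ U]) (auto simp: f_def)
  moreover have "(deriv ^^ l) f y = 0" if "y \<in> S - A" for y l
  proof -
    have "(deriv ^^ l) f y = (deriv ^^ l) (\<lambda>_. 0) y"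
      using that UV f by (intro higher_deriv_transform_within_open[of _ V]) (auto simp: f_def)
    thus ?thesis by simp
  qed
  ultimately show ?thesis by (rule that)
qed

text \<open>Near \<open>\<tau>\<close> the function is \<open>(z - \<tau>)^l / l!\<close>, elsewhere it is \<open>0\<close>.\<close>

lemma exists_jet_dual:
  assumes "finite S" "\<tau> \<in> S"
  obtains e where "e analytic_on S"
    "\<And>y k. y \<in> S \<Longrightarrow> (deriv ^^ k) e y = (if y = \<tau> \<and> k = l then 1 else 0)"
proof -
  let ?g = "\<lambda>z. inverse (fact l) * (z - \<tau>) ^ l"
  obtain e where e: "e analytic_on S"
    "\<And>y k. y \<in> {\<tau>} \<Longrightarrow> (deriv ^^ k) e y = (deriv ^^ k) ?g y"
    "\<And>y k. y \<in> S - {\<tau>} \<Longrightarrow> (deriv ^^ k) e y = 0"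
  proof (rule exists_piecewise_analytic[of S "{\<tau>}" ?g])
    show "?g holomorphic_on UNIV" by (intro holomorphic_intros)
  qed (use assms in auto)
  have "(deriv ^^ k) ?g \<tau> = (if k = l then 1 else 0)" for k
  proof -
    have "(deriv ^^ k) ?g \<tau> = inverse (fact l) * (deriv ^^ k) (\<lambda>z. (z - \<tau>) ^ l) \<tau>"
      by (intro higher_deriv_cmult[of _ UNIV]) (auto intro!: holomorphic_intros)
    also have "(deriv ^^ k) (\<lambda>z. (z - \<tau>) ^ l) \<tau> = (if k = l then fact l else 0)"
      by (cases k l rule: linorder_cases) (auto simp: higher_deriv_power pochhammer_fact pochhammer_0_left)
    finally show ?thesis by simp
  qed
  with e show ?thesis using that[of e] by (metis Diff_iff singletonD singletonI)
qed

lemma higher_deriv_poly: "(deriv ^^ l) (poly p) = poly ((pderiv ^^ l) p)" for p :: "complex poly"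
proof (induction l)
  case (Suc l)
  show ?case
    unfolding funpow.simps o_apply Suc.IH by (intro ext DERIV_imp_deriv poly_DERIV)
qed simp

text \<open>The interpolation polynomial of \<open>f\<close> is the combination, with the jets of \<open>f\<close> as coefficients,
  of the interpolation polynomials of the functions dual to these jets. Comparing top coefficients
  gives constants \<open>c\<close> that do not depend on \<open>f\<close>.\<close>

lemma divided_difference_expansion:
  assumes "ys \<noteq> []"
  obtains c where "\<And>f. f analytic_on set ys \<Longrightarrow> divided_difference ys f =
    (\<Sum>(y, l)\<in>(SIGMA y:set ys. {..<count_list ys y}). c (y, l) * (deriv ^^ l) f y)"
proof -
  let ?I = "SIGMA y:set ys. {..<count_list ys y}"
  have "\<forall>i\<in>?I. \<exists>e. e analytic_on set ys \<and>
      (\<forall>y\<in>set ys. \<forall>k. (deriv ^^ k) e y = (if y = fst i \<and> k = snd i then 1 else 0))"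
  proof
    fix i assume "i \<in> ?I"
    hence "fst i \<in> set ys" by auto
    with finite_set show "\<exists>e. e analytic_on set ys \<and>
        (\<forall>y\<in>set ys. \<forall>k. (deriv ^^ k) e y = (if y = fst i \<and> k = snd i then 1 else 0))"
      by (rule exists_jet_dual) (intro exI conjI ballI allI)
  qed
  from bchoice[OF this] obtain e where "\<forall>i\<in>?I. e i analytic_on set ys \<and>
      (\<forall>y\<in>set ys. \<forall>k. (deriv ^^ k) (e i) y = (if y = fst i \<and> k = snd i then 1 else 0))"
    by (elim exE)
  hence e: "\<And>i. i \<in> ?I \<Longrightarrow> e i analytic_on set ys"
    "\<And>i y k. i \<in> ?I \<Longrightarrow> y \<in> set ys \<Longrightarrow> (deriv ^^ k) (e i) y = (if y = fst i \<and> k = snd i then 1 else 0)"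
    using bspec[of ?I] by (meson, meson)
  have "divided_difference ys f =
      (\<Sum>(y, l)\<in>?I. coeff (newton_poly ys (e (y, l))) (length ys - 1) * (deriv ^^ l) f y)"
    if f: "f analytic_on set ys" for f
  proof -
    define P where "P = (\<Sum>i\<in>?I. smult ((deriv ^^ snd i) f (fst i)) (newton_poly ys (e i)))"
    have "jets_agree ys f (poly P)"
      unfolding jets_agree_def
    proof safe
      fix y l assume y: "y \<in> set ys" "l < count_list ys y"
      have "(deriv ^^ l) (poly P) y =
          (\<Sum>i\<in>?I. (deriv ^^ snd i) f (fst i) * (deriv ^^ l) (poly (newton_poly ys (e i))) y)"
        by (simp add: P_def higher_deriv_poly higher_pderiv_sum higher_pderiv_smult poly_sum)
      also have "\<dots> = (\<Sum>i\<in>?I. if i = (y, l) then (deriv ^^ l) f y else 0)"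
        using y jets_agree_newton_poly[OF e(1)] e(2)
        by (intro sum.cong refl) (auto simp: jets_agree_def)
      also have "\<dots> = (deriv ^^ l) f y" using y by (subst sum.delta) auto
      finally show "(deriv ^^ l) f y = (deriv ^^ l) (poly P) y" by simp
    qed
    moreover have "degree P \<le> length ys - 1"
      unfolding P_def
      by (intro degree_sum_le order_trans[OF degree_smult_le] degree_newton_poly) auto
    ultimately have "divided_difference ys f = coeff P (length ys - 1)"
      using divided_difference_poly[OF assms] by blast
    thus ?thesis
      by (simp add: P_def coeff_sum case_prod_unfold mult.commute)
  qed
  thus ?thesis using that[of "\<lambda>i. coeff (newton_poly ys (e i)) (length ys - 1)"] by auto
qed

section \<open>The space of functionals and the family of a configuration\<close>

definition node_list :: "complex ^ 'n::{finite,linorder} \<Rightarrow> 'n set \<Rightarrow> complex list" where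
  "node_list w X = map (\<lambda>i. w $ i) (sorted_list_of_set X)"

lemma set_node_list [simp]: "set (node_list w X) = (\<lambda>i. w $ i) ` X"
  by (simp add: node_list_def)

lemma length_node_list [simp]: "length (node_list w X) = card X"
  by (simp add: node_list_def)

lemma set_node_list_subset: "set (node_list w X) \<subseteq> nodes w"
  by (auto simp: nodes_def)

lemma count_node_list: "count_list (node_list w X) y = card {i \<in> X. w $ i = y}"
proof -
  have "count_list (node_list w X) y = length (filter (\<lambda>i. w $ i = y) (sorted_list_of_set X))"
    by (simp add: node_list_def count_list_eq_length_filter filter_map o_def eq_commute)
  also have "\<dots> = card (set (filter (\<lambda>i. w $ i = y) (sorted_list_of_set X)))"
    by (intro distinct_card[symmetric] distinct_filter) simp
  finally show ?thesis by simp
qed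

lemma sorted_list_of_initial_part:
  "sorted_list_of_set (initial_part X m) = take m (sorted_list_of_set X)"
  unfolding initial_part_def
  by (intro sorted_list_of_set.idem_if_sorted_distinct) (auto intro: sorted_wrt_take)

lemma initial_part_subset: "initial_part X m \<subseteq> X"
  using set_take_subset[of m "sorted_list_of_set X"] by (simp add: initial_part_def)

lemma node_list_initial_part: "node_list w (initial_part X m) = take m (node_list w X)"
  by (simp add: node_list_def sorted_list_of_initial_part take_map)

lemma initial_part_nonempty:
  assumes "(X, m) \<in> family_index C"
  shows "initial_part X m \<noteq> {}"
  using assms by (auto simp: initial_part_def family_index_def)

lemma B_family_apply:
  assumes "f analytic_on nodes w"
  shows "B_family w (X, m) f = divided_difference (take m (node_list w X)) f"
  using assms node_list_initial_part[of w X m]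
  by (simp add: B_family_def Delta_def near_nodes_def node_list_def)

lemma sum_functional_apply: "(\<Sum>i\<in>I. \<phi> i :: functional) f = (\<Sum>i\<in>I. \<phi> i f)"
  by (induction I rule: infinite_finite_induct) auto

lemma finite_nodes [simp]: "finite (nodes w)" for w :: "complex ^ 'n::finite"
  by (simp add: nodes_def)

lemma Delta_in_V_space:
  fixes w :: "complex ^ 'n::{finite,linorder}"
  assumes "X \<noteq> {}"
  shows "Delta X w \<in> V_space w"
proof -
  let ?ys = "node_list w X"
  let ?I = "SIGMA y:set ?ys. {..<count_list ?ys y}"
  have "?ys \<noteq> []" using assms by (metis card_0_eq finite length_0_conv length_node_list)
  then obtain c where c: "\<And>f. f analytic_on set ?ys \<Longrightarrow>
      divided_difference ?ys f = (\<Sum>(y, l)\<in>?I. c (y, l) * (deriv ^^ l) f y)"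
    using divided_difference_expansion by blast
  have "Delta X w = (\<Sum>(y, l)\<in>?I. (\<lambda>f. c (y, l) * delta w l y f))"
  proof
    fix f
    show "Delta X w f = (\<Sum>(y, l)\<in>?I. (\<lambda>f. c (y, l) * delta w l y f)) f"
    proof (cases "f analytic_on nodes w")
      case True
      hence "f analytic_on set ?ys" using set_node_list_subset analytic_on_subset by blast
      with c[of f] True show ?thesis
        by (simp add: Delta_def delta_def near_nodes_def sum_functional_apply case_prod_unfold
            flip: node_list_def)
    qed (simp add: Delta_def delta_def near_nodes_def sum_functional_apply case_prod_unfold)
  qed
  also have "\<dots> \<in> V_space w"
    unfolding V_space_def
  proof (intro functional.span_sum, clarify, intro functional.span_scale functional.span_base)
    fix y l assume *: "y \<in> set ?ys" "l < count_list ?ys y"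
    moreover have "count_list ?ys y \<le> node_mult w y"
      unfolding count_node_list node_mult_def by (intro card_mono) auto
    ultimately show "delta w l y \<in> {delta w l \<tau> |l \<tau>. \<tau> \<in> nodes w \<and> l < node_mult w \<tau>}"
      using set_node_list_subset[of w X] by fastforce
  qed
  finally show ?thesis .
qed

text \<open>The multiplicities of the distinct node values add up to the number of indices. An upper bound
  on the number of generators suffices, since the independent family has exactly that size.\<close>

lemma V_space_span_bound:
  fixes w :: "complex ^ 'n::finite"
  obtains T where "finite T" "card T \<le> CARD('n)" "V_space w = functional.span T"
proof -
  let ?I = "SIGMA \<tau>:nodes w. {..<node_mult w \<tau>}"
  let ?T = "(\<lambda>(\<tau>, l). delta w l \<tau>) ` ?I"
  have "card ?T \<le> card ?I" by (intro card_image_le) auto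
  also have "\<dots> = (\<Sum>\<tau>\<in>nodes w. card {i. w $ i = \<tau>})" by (simp add: node_mult_def)
  also have "\<dots> = CARD('n)"
    using card_eq_sum sum.image_gen[of "UNIV :: 'n set" "\<lambda>_. 1::nat" "\<lambda>i. w $ i"]
    by (simp add: nodes_def)
  finally have "card ?T \<le> CARD('n)" .
  moreover have "V_space w = functional.span ?T"
    unfolding V_space_def by (intro arg_cong[where f = functional.span]) auto
  ultimately show ?thesis using that[of ?T] by auto
qed

lemma card_family_index:
  fixes C :: "'n::finite set set"
  assumes "configuration C"
  shows "card (family_index C) = CARD('n)"
proof -
  have C: "\<Union>C = UNIV" "disjoint C"
    using assms by (auto simp: configuration_def partition_on_def)
  have "card (family_index C) = (\<Sum>X\<in>C. card X)" by (simp add: family_index_def)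
  also have "\<dots> = card (\<Union>C)"
    using C(2) by (intro card_Union_disjoint[symmetric]) (auto simp: disjoint_def pairwise_def)
  finally show ?thesis by (simp add: C)
qed

lemma dual_family_independent:
  assumes "finite I" "\<And>i j. i \<in> I \<Longrightarrow> j \<in> I \<Longrightarrow> b j (t i) = (if j = i then 1 else 0)"
  shows "inj_on b I" "functional.independent (b ` I)"
proof -
  show inj: "inj_on b I"
  proof (rule inj_onI)
    fix i j assume ij: "i \<in> I" "j \<in> I" "b i = b j"
    have "b j (t i) = 1" using assms(2)[OF ij(1,1)] ij(3) by simp
    thus "i = j" using assms(2)[OF ij(1,2)] by (auto split: if_splits)
  qed
  have zero: "g \<phi> = 0"
    if sum0: "(\<Sum>\<phi>\<in>b ` I. (\<lambda>f. g \<phi> * \<phi> f)) = 0" and \<phi>: "\<phi> \<in> b ` I"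
    for g :: "functional \<Rightarrow> complex" and \<phi>
  proof -
    from \<phi> obtain i where i: "i \<in> I" "\<phi> = b i" by (elim imageE)
    have "0 = (\<Sum>\<phi>\<in>b ` I. (\<lambda>f. g \<phi> * \<phi> f)) (t i)"
      unfolding sum0 by (simp only: zero_fun_apply)
    also have "\<dots> = (\<Sum>j\<in>I. g (b j) * b j (t i))"
      by (simp only: sum_functional_apply sum.reindex[OF inj] o_def)
    also have "\<dots> = (\<Sum>j\<in>I. if j = i then g (b i) else 0)"
      using i(1) assms(2) by (intro sum.cong) auto
    also have "\<dots> = g \<phi>" using i assms(1) by simp
    finally show ?thesis by simp
  qed
  show "functional.independent (b ` I)"
  proof
    assume "functional.dependent (b ` I)"
    then obtain g \<phi> where "\<phi> \<in> b ` I" "g \<phi> \<noteq> 0" "(\<Sum>\<phi>\<in>b ` I. (\<lambda>f. g \<phi> * \<phi> f)) = 0"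
      unfolding functional.dependent_finite[OF finite_imageI[OF assms(1)]]
      by (elim exE conjE bexE)
    thus False using zero[of g \<phi>] by simp
  qed
qed

text \<open>An element outside the span could be added to the family, giving more independent elements than
  the generating set \<open>T\<close> permits.\<close>

lemma is_basis_familyI:
  assumes "finite I" "inj_on b I" "functional.independent (b ` I)" "b ` I \<subseteq> functional.span T"
    "finite T" "card T \<le> card I"
  shows "is_basis_family I b (functional.span T)"
proof -
  have "functional.span T \<subseteq> functional.span (b ` I)"
  proof
    fix \<phi> assume \<phi>: "\<phi> \<in> functional.span T"
    show "\<phi> \<in> functional.span (b ` I)"
    proof (rule ccontr)
      assume n: "\<phi> \<notin> functional.span (b ` I)"
      hence "functional.independent (insert \<phi> (b ` I))"
        using assms(3) by (rule functional.independent_insertI)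
      hence "card (insert \<phi> (b ` I)) \<le> card T"
        using functional.independent_span_bound[of T "insert \<phi> (b ` I)"] assms \<phi> by blast
      moreover have "\<phi> \<notin> b ` I" using n functional.span_base by blast
      ultimately show False using assms by (simp add: card_image)
    qed
  qed
  moreover have "functional.span (b ` I) \<subseteq> functional.span T"
    using assms(4) by (intro functional.span_minimal functional.subspace_span)
  ultimately show ?thesis using assms by (auto simp: is_basis_family_def)
qed

lemma monic_linear_factors:
  "degree (\<Prod>y\<leftarrow>ys. [:- y, 1:]) = length ys \<and> lead_coeff (\<Prod>y\<leftarrow>ys. [:- y, 1 :: complex:]) = 1"
proof (induction ys)
  case (Cons y ys)
  let ?P = "\<Prod>y\<leftarrow>ys. [:- y, 1 :: complex:]"
  have "?P \<noteq> 0" using Cons by auto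
  hence "degree ([:- y, 1:] * ?P) = length (y # ys)"
    using Cons by (subst degree_mult_eq) auto
  moreover have "lead_coeff ([:- y, 1:] * ?P) = 1"
    unfolding lead_coeff_mult using conjunct2[OF Cons] by (simp only: lead_coeff_pCons) simp
  ultimately show ?case by (simp only: list.map prod_list.Cons)
qed auto

lemma poly_linear_factors:
  "poly (\<Prod>y\<leftarrow>ys. [:- y, 1 :: complex:]) z = (\<Prod>y\<leftarrow>ys. z - y)"
  by (induction ys) (auto simp: algebra_simps)

text \<open>The test function is the Newton polynomial \<open>P\<close> of the first \<open>m - 1\<close> nodes of \<open>X\<close>, cut off to the
  nodes of \<open>X\<close>. Subordination enters only to make the nodes of the other blocks
  different from those of \<open>X\<close>, so that the cut-off leaves zero jets there.\<close>

lemma B_family_dual_function: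
  fixes w :: "complex ^ 'n::{finite,linorder}"
  assumes C: "configuration C" and sub: "subordinated w C" and Xm: "(X, m) \<in> family_index C"
  obtains t where "\<And>j. j \<in> family_index C \<Longrightarrow> B_family w j t = (if j = (X, m) then 1 else 0)"
proof -
  let ?A = "(\<lambda>i. w $ i) ` X"
  let ?us = "take (m - 1) (node_list w X)"
  define P where "P = (\<Prod>y\<leftarrow>?us. [:- y, 1:])"
  have m: "1 \<le> m" "m \<le> card X" "X \<in> C" using Xm by (auto simp: family_index_def)
  have P: "degree P = m - 1" "coeff P (m - 1) = 1"
    using monic_linear_factors[of ?us] m by (auto simp: P_def)
  obtain t where t: "t analytic_on nodes w"
    "\<And>y l. y \<in> ?A \<Longrightarrow> (deriv ^^ l) t y = (deriv ^^ l) (poly P) y"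
    "\<And>y l. y \<in> nodes w - ?A \<Longrightarrow> (deriv ^^ l) t y = 0"
  proof (rule exists_piecewise_analytic[of "nodes w" ?A "poly P"])
    show "poly P holomorphic_on UNIV" by (intro holomorphic_intros)
  qed (auto simp: nodes_def)
  have "B_family w (Y, k) t = (if (Y, k) = (X, m) then 1 else 0)" if "(Y, k) \<in> family_index C" for Y k
  proof -
    have k: "1 \<le> k" "k \<le> card Y" "Y \<in> C" using that by (auto simp: family_index_def)
    define ys where "ys = take k (node_list w Y)"
    have ys: "length ys = k" "ys \<noteq> []" "set ys \<subseteq> (\<lambda>i. w $ i) ` Y"
    proof -
      show "length ys = k" using k by (simp add: ys_def)
      with k show "ys \<noteq> []" by auto
      show "set ys \<subseteq> (\<lambda>i. w $ i) ` Y"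
        using set_take_subset[of k "node_list w Y"] by (simp add: ys_def)
    qed
    have B: "B_family w (Y, k) t = divided_difference ys t"
      using B_family_apply[OF t(1)] by (simp add: ys_def)
    consider "Y \<noteq> X" | "Y = X" "m \<le> k" | "Y = X" "k < m" by linarith
    thus ?thesis
    proof cases
      case 1
      have notin: "w $ i \<notin> ?A" if i: "i \<in> Y" for i
      proof
        assume "w $ i \<in> ?A"
        then obtain j where j: "j \<in> X" "w $ i = w $ j" by blast
        have disj: "Z = Z'" if "Z \<in> C" "Z' \<in> C" "x \<in> Z" "x \<in> Z'" for Z Z' x
          using C that by (auto simp: configuration_def partition_on_def disjoint_def)
        have "i \<noteq> j" using disj[OF m(3) k(3)] i j 1 by blast
        then obtain Z where "Z \<in> C" "i \<in> Z" "j \<in> Z"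
          using sub j unfolding subordinated_def by blast
        thus False using disj m(3) k(3) i j 1 by metis
      qed
      have "set ys \<subseteq> nodes w - ?A"
      proof
        fix y assume "y \<in> set ys"
        then obtain i where "i \<in> Y" "y = w $ i" using ys(3) by auto
        with notin[of i] show "y \<in> nodes w - ?A" by (simp add: nodes_def)
      qed
      hence "jets_agree ys t (\<lambda>_. 0)"
        using t(3) by (auto simp: jets_agree_def subset_iff)
      hence "divided_difference ys t = 0"
        using divided_difference_eq_0 ys by simp
      thus ?thesis using B 1 by simp
    next
      \<comment> \<open>\<open>P\<close> is its own interpolation polynomial, of degree \<open>m - 1 \<le> k - 1\<close>.\<close>
      case 2
      hence "jets_agree ys t (poly P)"
        using t(2) ys(3) by (auto simp: jets_agree_def subset_iff)
      hence "divided_difference ys t = coeff P (k - 1)"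
        using divided_difference_poly[of ys P t] ys P 2 by simp
      thus ?thesis using B P 2 m by (auto simp: coeff_eq_0)
    next
      case 3
      \<comment> \<open>All nodes in \<open>ys\<close> are roots of \<open>P\<close>, with at least the multiplicity they have in \<open>ys\<close>.\<close>
      have "k \<le> m - 1" using 3 by linarith
      hence "ys = take k ?us" using 3(1) by (simp add: ys_def min_def)
      hence "?us = ys @ drop k ?us" by (simp only: append_take_drop_id)
      hence "poly P z = (\<Prod>y\<leftarrow>ys. z - y) * (\<Prod>y\<leftarrow>drop k ?us. z - y)" for z
        unfolding P_def poly_linear_factors by (metis map_append prod_list.append)
      hence "poly P = (\<lambda>z. (\<Prod>y\<leftarrow>ys. z - y) * (\<Prod>y\<leftarrow>drop k ?us. z - y))" by (rule ext)
      hence "jets_agree ys (poly P) (\<lambda>_. 0)"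
        using jets_agree_nodal_multiple[of UNIV] holomorphic_prod_list_linear by simp
      hence "jets_agree ys t (\<lambda>_. 0)"
        using t(2) ys(3) 3 by (auto simp: jets_agree_def subset_iff)
      hence "divided_difference ys t = 0"
        using divided_difference_eq_0 ys by simp
      thus ?thesis using B 3 by simp
    qed
  qed
  hence "B_family w j t = (if j = (X, m) then 1 else 0)" if "j \<in> family_index C" for j
    using that by (cases j) blast
  thus ?thesis by (rule that)
qed

lemma finite_family_index [simp]: "finite (family_index C)" for C :: "'n::finite set set"
  unfolding family_index_def by (intro finite_SigmaI) auto

lemma B_family_in_V_space:
  "i \<in> family_index C \<Longrightarrow> B_family w i \<in> V_space w"
  by (cases i) (auto simp: B_family_def intro: Delta_in_V_space dest: initial_part_nonempty)

lemma subordinated_imp_basis: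
  fixes w :: "complex ^ 'n::{finite,linorder}"
  assumes "configuration C" "subordinated w C"
  shows "is_basis_family (family_index C) (B_family w) (V_space w)"
proof -
  have "\<exists>t. \<forall>j\<in>family_index C. B_family w j t = (if j = i then 1 else 0)"
    if "i \<in> family_index C" for i
    using that B_family_dual_function[OF assms] by (metis prod.collapse)
  then obtain t where t: "\<And>i j. i \<in> family_index C \<Longrightarrow> j \<in> family_index C \<Longrightarrow>
      B_family w j (t i) = (if j = i then 1 else 0)"
    by metis
  obtain T where T: "finite T" "card T \<le> CARD('n)" "V_space w = functional.span T"
    using V_space_span_bound by blast
  have "B_family w ` family_index C \<subseteq> V_space w" using B_family_in_V_space by blast
  thus ?thesis
    unfolding T(3) using T card_family_index[OF assms(1)] dual_family_independent[OF _ t]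
    by (intro is_basis_familyI) auto
qed

text \<open>Let \<open>k\<close> and \<open>l\<close> lie in different blocks and have the common value \<open>\<tau>\<close>. A block misses \<open>k\<close> or \<open>l\<close>,
  so it contains fewer than \<open>\<mu>\<close> indices with value \<open>\<tau>\<close>. The function \<open>e\<close> whose only nonzero
  derivative at a node is the one of order \<open>\<mu> - 1\<close> at \<open>\<tau>\<close> is then killed by the whole family but
  not by an element of \<open>V_space w\<close>.\<close>

lemma basis_imp_subordinated:
  fixes w :: "complex ^ 'n::{finite,linorder}"
  assumes C: "configuration C"
    and basis: "is_basis_family (family_index C) (B_family w) (V_space w)"
  shows "subordinated w C"
proof (rule ccontr)
  assume "\<not> subordinated w C"
  then obtain k l where kl: "w $ k = w $ l" "\<And>X. X \<in> C \<Longrightarrow> k \<notin> X \<or> l \<notin> X"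
    unfolding subordinated_def by blast
  define \<tau> where "\<tau> = w $ k"
  define \<mu> where "\<mu> = node_mult w \<tau>"
  have \<tau>: "\<tau> \<in> nodes w" by (auto simp: \<tau>_def nodes_def)
  have less: "card {i \<in> X. w $ i = \<tau>} < \<mu>" if "X \<in> C" for X
    unfolding \<mu>_def node_mult_def
    using kl(2)[OF that] kl(1) by (intro psubset_card_mono) (auto simp: \<tau>_def)
  have "\<mu> > 0" unfolding \<mu>_def node_mult_def by (auto simp: card_gt_0_iff \<tau>_def)
  obtain e where e: "e analytic_on nodes w"
    "\<And>y j. y \<in> nodes w \<Longrightarrow> (deriv ^^ j) e y = (if y = \<tau> \<and> j = \<mu> - 1 then 1 else 0)"
    using exists_jet_dual[OF finite_nodes \<tau>] by blast
  have B0: "B_family w i e = 0" if i: "i \<in> family_index C" for i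
  proof -
    obtain X m where Xm: "i = (X, m)" by fastforce
    define ys where "ys = node_list w (initial_part X m)"
    have X: "X \<in> C" using i Xm by (auto simp: family_index_def)
    have "count_list ys \<tau> \<le> card {i \<in> X. w $ i = \<tau>}"
      unfolding ys_def count_node_list using initial_part_subset[of X m]
      by (intro card_mono) auto
    hence "count_list ys \<tau> \<le> \<mu> - 1" using less[OF X] by linarith
    moreover have "set ys \<subseteq> nodes w" unfolding ys_def by (rule set_node_list_subset)
    ultimately have "jets_agree ys e (\<lambda>_. 0)"
      using e(2) by (auto simp: jets_agree_def subset_iff)
    moreover have "ys \<noteq> []"
      using initial_part_nonempty[of X m C] i Xm
      by (metis card_0_eq finite length_0_conv length_node_list ys_def)
    ultimately have "divided_difference ys e = 0"
      using divided_difference_eq_0 by simp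
    thus ?thesis
      using B_family_apply[OF e(1)] by (simp add: Xm ys_def node_list_initial_part)
  qed
  have "delta w (\<mu> - 1) \<tau> \<in> V_space w"
    unfolding V_space_def using \<tau> \<open>\<mu> > 0\<close> by (intro functional.span_base CollectI exI[of _ "\<mu> - 1"] exI[of _ \<tau>] conjI)
      (auto simp: \<mu>_def)
  hence "delta w (\<mu> - 1) \<tau> \<in> functional.span (B_family w ` family_index C)"
    using basis by (simp add: is_basis_family_def)
  also have "\<dots> \<subseteq> {\<phi>. \<phi> e = 0}"
    by (rule functional.span_minimal) (auto simp: B0 functional.subspace_def)
  finally have "(deriv ^^ (\<mu> - 1)) e \<tau> = 0"
    using e(1) by (simp add: delta_def near_nodes_def)
  thus False using e(2)[OF \<tau>] by simp
qed

section \<open>Continuity of the family and openness of subordination\<close>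

text \<open>The points \<open>w\<close> at which \<open>f\<close> is admissible are those whose nodes lie in the largest open set on
  which \<open>f\<close> is holomorphic. On this set of points the divided difference is an iterated quotient with a
  fixed domain of holomorphy, so it is continuous there.\<close>

lemma continuous_functionals_B_family:
  fixes U :: "(complex ^ 'n::{finite,linorder}) set"
  assumes "i \<in> family_index C"
  shows "continuous_functionals_on U (\<lambda>w. B_family w i)"
  unfolding continuous_functionals_on_def
proof
  fix f :: "complex \<Rightarrow> complex"
  obtain X m where Xm: "i = (X, m)" by fastforce
  define js where "js = sorted_list_of_set (initial_part X m)"
  have ne: "js \<noteq> []"
    using initial_part_nonempty[of X m C] assms by (simp add: js_def Xm)
  define S where "S = \<Union>{T. open T \<and> f holomorphic_on T}"
  have S: "open S" "f holomorphic_on S"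
    unfolding S_def by (auto intro!: holomorphic_on_UN_open[where f = f and A = id, simplified])
  let ?A = "{w \<in> U. f analytic_on nodes w}"
  have node: "w $ j \<in> S" if "w \<in> ?A" for w :: "complex ^ 'n::{finite,linorder}" and j
    using that unfolding analytic_on_holomorphic S_def nodes_def by blast
  have "continuous_on ?A (\<lambda>w. iterated_quotient (map (\<lambda>y. y w) (map (\<lambda>j w. w $ j) js)) f)"
  proof (rule continuous_on_iterated_quotient[OF S(1)])
    have "continuous_on S f" using S(2) by (rule holomorphic_on_imp_continuous_on)
    thus "continuous_on (?A \<times> S) (\<lambda>(w, z). f z)"
      unfolding case_prod_unfold
      by (rule continuous_on_compose2) (auto intro!: continuous_intros)
  qed (use S(2) node in \<open>auto intro!: continuous_intros\<close>)
  also have "?this \<longleftrightarrow> continuous_on ?A (\<lambda>w. B_family w i f)"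
  proof (intro continuous_on_cong refl)
    fix w assume w: "w \<in> ?A"
    hence "f analytic_on set (node_list w (initial_part X m))"
      using set_node_list_subset analytic_on_subset by blast
    thus "iterated_quotient (map (\<lambda>y. y w) (map (\<lambda>j w. w $ j) js)) f = B_family w i f"
      using w ne divided_difference_eq_iterated_quotient[of "node_list w (initial_part X m)" f]
      unfolding Xm B_family_apply[OF conjunct2[OF w[unfolded mem_Collect_eq]]]
        node_list_initial_part[symmetric]
      by (simp add: node_list_def js_def o_def)
  qed
  finally show "continuous_on ?A (\<lambda>w. B_family w i f)" .
qed

lemma open_subordinated: "open {w :: complex ^ 'n::finite. subordinated w C}"
proof -
  have "{w :: complex ^ 'n. subordinated w C} =
      (\<Inter>(k, l)\<in>{(k, l). k \<noteq> l \<and> \<not> (\<exists>X\<in>C. k \<in> X \<and> l \<in> X)}. {w. w $ k \<noteq> w $ l})"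
    by (auto simp: subordinated_def)
  moreover have "open {w :: complex ^ 'n. w $ k \<noteq> w $ l}" for k l
    by (intro open_Collect_neq continuous_intros)
  ultimately show ?thesis by (auto intro!: open_INT)
qed

theorem theorem6p11:
  fixes w0 :: "complex ^ 'n::{finite,linorder}" and C :: "'n set set"
  assumes "configuration C"
  shows "(is_basis_family (family_index C) (B_family w0) (V_space w0) \<longleftrightarrow> subordinated w0 C) \<and>
    (subordinated w0 C \<longrightarrow>
      (\<exists>U. open U \<and> w0 \<in> U \<and>
        (\<forall>w\<in>U. is_basis_family (family_index C) (B_family w) (V_space w)) \<and>
        (\<forall>i\<in>family_index C. continuous_functionals_on U (\<lambda>w. B_family w i))))"
proof (intro conjI impI)
  show "is_basis_family (family_index C) (B_family w0) (V_space w0) \<longleftrightarrow> subordinated w0 C"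
    using basis_imp_subordinated subordinated_imp_basis assms by blast
  assume "subordinated w0 C"
  thus "\<exists>U. open U \<and> w0 \<in> U \<and>
      (\<forall>w\<in>U. is_basis_family (family_index C) (B_family w) (V_space w)) \<and>
      (\<forall>i\<in>family_index C. continuous_functionals_on U (\<lambda>w. B_family w i))"
    using open_subordinated[of C] subordinated_imp_basis[OF assms] continuous_functionals_B_family
    by (intro exI[of _ "{w. subordinated w C}"]) auto
qed

end
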